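(* Let $m\ge 2$. For $n\ge 0$ define $$Q^{(m)}_{n,132}(x_2,\ldots,x_m)=\sum_{\sigma\in\mathcal{S}_n(132)}x_2^{\mathrm{occr}_{12}(\sigma)}x_3^{\mathrm{occr}_{123}(\sigma)}\cdots x_m^{\mathrm{occr}_{12\cdots m}(\sigma)},\qquad Q^{(m)}_{132}(t,x_2,\ldots,x_m)=\sum_{n\ge 0}t^n Q^{(m)}_{n,132}(x_2,\ldots,x_m).$$ Then for every $n\ge 1$, $$Q^{(m)}_{n,132}(x_2,\ldots,x_m)=\sum_{k=1}^{n}x_2^{k-1}\,Q^{(m)}_{k-1,132}(x_2x_3,\,x_3x_4,\ldots,x_{m-1}x_m,\,x_m)\,Q^{(m)}_{n-k,132}(x_2,\ldots,x_m),$$ and $$Q^{(m)}_{132}(t,x_2,\ldots,x_m)=1+t\,Q^{(m)}_{132}(tx_2,\,x_2x_3,\,x_3x_4,\ldots,x_{m-1}x_m,\,x_m)\,Q^{(m)}_{132}(t,x_2,\ldots,x_m).$$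
   Context: $\mathcal{S}_n$ is the set of permutations of $\{1,\ldots,n\}$ in one-line notation ($\mathcal{S}_0$ consists of the empty permutation, so the $n=0$ polynomial is $1$). For a sequence $w$ of distinct integers, $\mathrm{red}(w)$ is the permutation obtained by replacing the $i$-th smallest entry of $w$ by $i$. For $\tau\in\mathcal{S}_j$ and $\sigma=\sigma_1\cdots\sigma_n\in\mathcal{S}_n$, $\mathrm{occr}_\tau(\sigma)$ is the number of index sets $1\le i_1<\cdots<i_j\le n$ with $\mathrm{red}(\sigma_{i_1}\cdots\sigma_{i_j})=\tau$. $\mathcal{S}_n(132)$ is the set of $\sigma\in\mathcal{S}_n$ with $\mathrm{occr}_{132}(\sigma)=0$. In the argument list $(x_2x_3,x_3x_4,\ldots,x_{m-1}x_m,x_m)$ the variable $x_i$ is replaced by $x_ix_{i+1}$ for $2\le i\le m-1$ and $x_m$ is left unchanged (for $m=2$ the list is just $(x_2)$). *)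

theory Defs
  imports "HOL-Combinatorics.Multiset_Permutations"
    "HOL-Computational_Algebra.Formal_Power_Series"
begin

definition red :: "'a::linorder list \<Rightarrow> nat list" where
  "red w = map (\<lambda>a. card {b \<in> set w. b \<le> a}) w"

text \<open>Positions in lists are counted from 0, so index sets are subsets of
  \<open>{0, \<dots>, n - 1}\<close> instead of \<open>{1, \<dots>, n}\<close>.\<close>

definition occr :: "nat list \<Rightarrow> nat list \<Rightarrow> nat" where
  "occr \<tau> \<sigma> =
     card {I. I \<subseteq> {..<length \<sigma>} \<and> card I = length \<tau> \<and> red (nths \<sigma> I) = \<tau>}"

definition Av132 :: "nat \<Rightarrow> nat list set" where
  "Av132 n = {\<sigma> \<in> permutations_of_set {1..n}. occr [1, 3, 2] \<sigma> = 0}"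

text \<open>The arguments \<open>x\<^sub>2, \<dots>, x\<^sub>m\<close> are elements of an arbitrary commutative
  ring; the values of \<open>x\<close> outside \<open>{2..m}\<close> are irrelevant. The polynomial itself is the
  case where the ring is a polynomial ring over the integers and the \<open>x\<^sub>i\<close> are its
  indeterminates, and an identity proved for all commutative rings is an identity of
  polynomials.\<close>

definition Qpoly :: "nat \<Rightarrow> nat \<Rightarrow> (nat \<Rightarrow> 'a::comm_ring_1) \<Rightarrow> 'a" where
  "Qpoly m n x = (\<Sum>\<sigma>\<in>Av132 n. \<Prod>i=2..m. x i ^ occr [1..<Suc i] \<sigma>)"

text \<open>The variable \<open>t\<close> is \<^const>\<open>fps_X\<close>.\<close>

definition Qgf :: "nat \<Rightarrow> (nat \<Rightarrow> 'a::comm_ring_1) \<Rightarrow> 'a fps" where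
  "Qgf m x = Abs_fps (\<lambda>n. Qpoly m n x)"

definition subst_args :: "nat \<Rightarrow> (nat \<Rightarrow> 'a::comm_ring_1) \<Rightarrow> nat \<Rightarrow> 'a" where
  "subst_args m x i = (if i < m then x i * x (Suc i) else x i)"

end

theory Submission
  imports Defs "HOL-Library.Sublist"
begin

text \<open>Write \<open>\<sigma> \<in> S\<^sub>n(132)\<close> as \<open>A n B\<close> with \<open>n\<close> in position \<open>k\<close>. Avoiding 132 forces every entry of
  \<open>A\<close> to exceed every entry of \<open>B\<close>, so \<open>\<sigma>\<close> corresponds to a pair of shorter 132-avoiding
  permutations, and no increasing subsequence meets both \<open>A\<close> and \<open>n B\<close> except by appending \<open>n\<close>
  to a subsequence of \<open>A\<close>. Hence \<open>occr\<^sub>i(\<sigma>) = occr\<^sub>i(A) + occr\<^sub>i\<^sub>-\<^sub>1(A) + occr\<^sub>i(B)\<close>, and the middle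
  term accounts for the substitution \<open>x\<^sub>i \<rightarrow> x\<^sub>i x\<^sub>i\<^sub>+\<^sub>1\<close> and the factor \<open>x\<^sub>2\<^sup>k\<^sup>-\<^sup>1\<close>.\<close>

section \<open>Reduction and relative order\<close>

lemma length_red [simp]: "length (red w) = length w"
  by (simp add: red_def)

lemma card_le_less_iff:
  fixes a :: "'a::linorder"
  assumes "finite S" "a \<in> S" "b \<in> S"
  shows "card {c \<in> S. c \<le> a} < card {c \<in> S. c \<le> b} \<longleftrightarrow> a < b"
proof
  assume "a < b"
  then have "{c \<in> S. c \<le> a} \<subset> {c \<in> S. c \<le> b}" using assms by force
  then show "card {c \<in> S. c \<le> a} < card {c \<in> S. c \<le> b}"
    using assms by (simp add: psubset_card_mono)
next
  assume less: "card {c \<in> S. c \<le> a} < card {c \<in> S. c \<le> b}"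
  show "a < b"
  proof (rule ccontr)
    assume "\<not> a < b"
    then have "{c \<in> S. c \<le> b} \<subseteq> {c \<in> S. c \<le> a}" by auto
    then have "card {c \<in> S. c \<le> b} \<le> card {c \<in> S. c \<le> a}"
      using assms(1) by (intro card_mono) auto
    then show False using less by simp
  qed
qed

lemma red_nth_less_iff:
  assumes "i < length w" "j < length w"
  shows "red w ! i < red w ! j \<longleftrightarrow> w ! i < w ! j"
  using assms by (simp add: red_def card_le_less_iff)

lemma sorted_wrt_less_red: "sorted_wrt (<) (red w) \<longleftrightarrow> sorted_wrt (<) w"
  by (auto simp: sorted_wrt_iff_nth_less red_nth_less_iff)

lemma set_red_subset: "set (red w) \<subseteq> {1..length w}"
proof -
  have "card {b \<in> set w. b \<le> a} \<in> {1..length w}" if "a \<in> set w" for a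
  proof -
    have "card {b \<in> set w. b \<le> a} \<le> card (set w)" by (rule card_mono) auto
    also have "\<dots> \<le> length w" by (rule card_length)
    moreover have "card {b \<in> set w. b \<le> a} > 0" using that by (auto simp: card_gt_0_iff)
    ultimately show ?thesis by simp
  qed
  then show ?thesis by (auto simp: red_def)
qed

text \<open>Reduction preserves all comparisons, so it keeps a strictly increasing word strictly
  increasing. Its \<open>i\<close> distinct values lie in \<open>{1..i}\<close>, hence fill that
  interval, and a sorted distinct list is determined by its set.\<close>

lemma red_eq_upt_iff: "red w = [1..<Suc i] \<longleftrightarrow> length w = i \<and> sorted_wrt (<) w"
proof
  assume eq: "red w = [1..<Suc i]"
  have "length w = length (red w)" by simp
  also have "\<dots> = i" by (simp add: eq)
  finally have "length w = i" .
  moreover have "sorted_wrt (<) (red w)" unfolding eq by (rule sorted_wrt_upt)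
  ultimately show "length w = i \<and> sorted_wrt (<) w" by (simp add: sorted_wrt_less_red)
next
  assume w: "length w = i \<and> sorted_wrt (<) w"
  then have r: "sorted_wrt (<) (red w)" by (simp add: sorted_wrt_less_red)
  then have d: "distinct (red w)" "sorted (red w)" by (simp_all add: strict_sorted_iff)
  have "set (red w) = {1..i}"
    using set_red_subset[of w] w d by (intro card_subset_eq) (auto simp: distinct_card)
  also have "\<dots> = set [1..<Suc i]" by auto
  finally show "red w = [1..<Suc i]"
    using d by (intro sorted_distinct_set_unique) (auto simp del: upt_Suc)
qed

lemma red_eq_132_iff:
  "red w = [1, 3, 2] \<longleftrightarrow> (\<exists>a b c. w = [a, b, c] \<and> a < c \<and> c < b)"
proof
  assume eq: "red w = [1, 3, 2]"
  have l: "length w = length (red w)" by simp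
  then have "length w = 3" by (simp add: eq)
  then obtain a b c where w: "w = [a, b, c]"
    by (auto simp: numeral_3_eq_3 length_Suc_conv)
  then have "a < c" "c < b"
    using red_nth_less_iff[of 0 w 2] red_nth_less_iff[of 2 w 1] eq by simp_all
  then show "\<exists>a b c. w = [a, b, c] \<and> a < c \<and> c < b" using w by blast
next
  assume "\<exists>a b c. w = [a, b, c] \<and> a < c \<and> c < b"
  then obtain a b c where w: "w = [a, b, c]" and o: "a < c" "c < b" by blast
  have "{y \<in> set w. y \<le> a} = {a}" "{y \<in> set w. y \<le> b} = {a, b, c}" "{y \<in> set w. y \<le> c} = {a, c}"
    using w o by auto
  moreover have "a \<noteq> c" "b \<noteq> c" "a \<noteq> b" using o by auto
  ultimately show "red w = [1, 3, 2]" by (simp add: red_def w)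
qed

text \<open>A strictly monotone map preserves the rank of each entry. This is used for the shift
  that lifts the left block above the right one.\<close>

lemma red_map_strict_mono:
  fixes f :: "'a::linorder \<Rightarrow> 'b::linorder"
  assumes "strict_mono f"
  shows "red (map f w) = red w"
proof -
  have "card {b \<in> f ` set w. b \<le> f a} = card {b \<in> set w. b \<le> a}" for a
  proof -
    have "{b \<in> f ` set w. b \<le> f a} = f ` {b \<in> set w. b \<le> a}"
      using assms by (auto simp: strict_mono_less_eq)
    then show ?thesis
      using strict_mono_imp_inj_on[OF assms] by (simp add: card_image inj_on_subset)
  qed
  then show ?thesis by (simp add: red_def)
qed

section \<open>Occurrences as subsequences\<close>

lemma occr_map_strict_mono:
  "strict_mono f \<Longrightarrow> occr \<tau> (map f \<sigma>) = occr \<tau> \<sigma>"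
  by (simp add: occr_def nths_map red_map_strict_mono)

text \<open>Indices beyond the end select nothing. This bridges \<open>subseq_conv_nths\<close>,
  which yields an arbitrary index set, and \<open>occr\<close>, which counts sets of valid
  positions.\<close>

lemma nths_restrict_length: "nths xs {i. i < length xs \<and> i \<in> N} = nths xs N"
proof -
  have "filter (\<lambda>p. snd p < length xs \<and> snd p \<in> N) (zip xs [0..<length xs]) =
      filter (\<lambda>p. snd p \<in> N) (zip xs [0..<length xs])"
    by (rule filter_cong) (auto simp: in_set_zip)
  then show ?thesis by (simp add: nths_def)
qed

lemma subseq_set_subset: "subseq xs ys \<Longrightarrow> set xs \<subseteq> set ys"
  by (auto simp: subseq_conv_nths dest: in_set_nthsD)

lemma occr_132_eq_0_iff:
  "occr [1, 3, 2] \<sigma> = 0 \<longleftrightarrow> \<not> (\<exists>a b c. subseq [a, b, c] \<sigma> \<and> a < c \<and> c < b)"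
proof -
  let ?E = "{I. I \<subseteq> {..<length \<sigma>} \<and> card I = length [1, 3, 2::nat] \<and> red (nths \<sigma> I) = [1, 3, 2]}"
  \<comment> \<open>An infinite set also has \<open>card\<close> equal to 0, so finiteness is what
    lets a zero count mean that \<open>?E\<close> is empty.\<close>
  have "finite ?E" by (rule finite_subset[of _ "Pow {..<length \<sigma>}"]) auto
  then have "occr [1, 3, 2] \<sigma> = 0 \<longleftrightarrow> ?E = {}" by (simp add: occr_def)
  moreover have "?E \<noteq> {} \<longleftrightarrow> (\<exists>a b c. subseq [a, b, c] \<sigma> \<and> a < c \<and> c < b)"
  proof
    assume "?E \<noteq> {}"
    then obtain I where "red (nths \<sigma> I) = [1, 3, 2]" by auto
    then show "\<exists>a b c. subseq [a, b, c] \<sigma> \<and> a < c \<and> c < b"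
      by (metis red_eq_132_iff subseq_conv_nths)
  next
    assume "\<exists>a b c. subseq [a, b, c] \<sigma> \<and> a < c \<and> c < b"
    then obtain a b c N where N: "[a, b, c] = nths \<sigma> N" and o: "a < c" "c < b"
      by (auto simp: subseq_conv_nths)
    let ?I = "{i. i < length \<sigma> \<and> i \<in> N}"
    have nI: "nths \<sigma> ?I = nths \<sigma> N" by (rule nths_restrict_length)
    have "card ?I = length [a, b, c]" unfolding N by (simp add: length_nths)
    moreover have "red (nths \<sigma> ?I) = [1, 3, 2]"
      unfolding red_eq_132_iff nI using N o by metis
    ultimately have "?I \<in> ?E" by auto
    then show "?E \<noteq> {}" by blast
  qed
  ultimately show ?thesis by blast
qed

section \<open>Increasing subsequences of a word split at its maximum\<close>

text \<open>Words replace index sets here, so that cutting and concatenating lists acts on them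
  directly.\<close>

definition incr_subseqs :: "nat \<Rightarrow> nat list \<Rightarrow> nat list set" where
  "incr_subseqs i \<sigma> = {w. subseq w \<sigma> \<and> length w = i \<and> sorted_wrt (<) w}"

lemma finite_incr_subseqs: "finite (incr_subseqs i \<sigma>)"
  by (rule finite_subset[of _ "set (subseqs \<sigma>)"]) (auto simp: incr_subseqs_def)

text \<open>When entries are distinct, the entries of a selected word reveal their positions. Thus
  \<open>nths \<sigma>\<close> is injective on the counted index sets, and counting these sets is
  counting words.\<close>

lemma occr_incr:
  assumes "distinct \<sigma>"
  shows "occr [1..<Suc i] \<sigma> = card (incr_subseqs i \<sigma>)"
proof -
  let ?E = "{I. I \<subseteq> {..<length \<sigma>} \<and> card I = i \<and> red (nths \<sigma> I) = [1..<Suc i]}"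
  have inj: "inj_on (nths \<sigma>) ?E"
  proof (rule inj_onI)
    fix I J assume I: "I \<in> ?E" and J: "J \<in> ?E" and eq: "nths \<sigma> I = nths \<sigma> J"
    have "(!) \<sigma> ` I = set (nths \<sigma> I)" using I by (auto simp: set_nths)
    also have "\<dots> = (!) \<sigma> ` J" unfolding eq using J by (auto simp: set_nths)
    finally show "I = J"
      using I J assms inj_on_image_eq_iff[OF inj_on_nth, of \<sigma> "{..<length \<sigma>}" I J] by auto
  qed
  have "nths \<sigma> ` ?E = incr_subseqs i \<sigma>"
  proof (intro equalityI subsetI)
    fix w assume "w \<in> nths \<sigma> ` ?E"
    then show "w \<in> incr_subseqs i \<sigma>"
      unfolding red_eq_upt_iff by (auto simp: incr_subseqs_def subseq_conv_nths)
  next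
    fix w assume "w \<in> incr_subseqs i \<sigma>"
    then obtain N where w: "w = nths \<sigma> N" "length w = i" "sorted_wrt (<) w"
      by (auto simp: incr_subseqs_def subseq_conv_nths)
    let ?I = "{j. j < length \<sigma> \<and> j \<in> N}"
    have nI: "nths \<sigma> ?I = w" unfolding w(1) by (rule nths_restrict_length)
    have "card ?I = i" using w(1,2) by (simp add: length_nths)
    moreover have "red (nths \<sigma> ?I) = [1..<Suc i]" unfolding red_eq_upt_iff nI using w by blast
    ultimately have "?I \<in> ?E" by blast
    then show "w \<in> nths \<sigma> ` ?E" using nI by blast
  qed
  then have "card (incr_subseqs i \<sigma>) = card ?E" using card_image[OF inj] by simp
  then show ?thesis by (simp add: occr_def del: upt_Suc)
qed

lemma incr_subseqs_one: "incr_subseqs 1 \<sigma> = (\<lambda>a. [a]) ` set \<sigma>"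
  by (auto simp: incr_subseqs_def length_Suc_conv subseq_singleton_left)

text \<open>Cut an increasing subsequence into \<open>u\<close> from \<open>A\<close> and
  \<open>v\<close> from \<open>n # B\<close>. If \<open>v\<close> starts with \<open>n\<close>,
  nothing can follow, as \<open>n\<close> is the maximum; if \<open>v\<close> is nonempty inside
  \<open>B\<close>, then \<open>u\<close> is empty, as \<open>A\<close> lies above
  \<open>B\<close>.\<close>

lemma incr_subseqs_append_max:
  assumes BA: "\<And>a b. a \<in> set A \<Longrightarrow> b \<in> set B \<Longrightarrow> b < a"
    and An: "\<And>a. a \<in> set A \<Longrightarrow> a < n" and Bn: "\<And>b. b \<in> set B \<Longrightarrow> b < n"
  shows "incr_subseqs (Suc i) (A @ n # B) =
    incr_subseqs (Suc i) A \<union> (\<lambda>w. w @ [n]) ` incr_subseqs i A \<union> incr_subseqs (Suc i) B"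
    (is "?L = ?R")
proof (intro equalityI subsetI)
  fix w assume "w \<in> ?L"
  then have w: "subseq w (A @ n # B)" "length w = Suc i" "sorted_wrt (<) w"
    by (auto simp: incr_subseqs_def)
  then obtain u v where uv: "w = u @ v" "subseq u A" "subseq v (n # B)"
    by (auto elim: subseq_appendE)
  have uA: "set u \<subseteq> set A" using uv(2) by (rule subseq_set_subset)
  consider "v = []" | v' where "v = n # v'" "subseq v' B" | "v \<noteq> []" "subseq v B"
    using uv(3) by (cases v) (auto split: if_splits)
  then show "w \<in> ?R"
  proof cases
    case 1
    then show ?thesis using w uv by (auto simp: incr_subseqs_def)
  next
    case (2 v')
    have "set v' \<subseteq> set B" using 2(2) by (rule subseq_set_subset)
    moreover have "\<forall>b\<in>set v'. n < b" using w(3) uv(1) 2(1) by (auto simp: sorted_wrt_append)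
    ultimately have "v' = []" using Bn by (cases v') force+
    then have "w = u @ [n]" using uv(1) 2(1) by simp
    moreover have "u \<in> incr_subseqs i A"
      using w uv(2) \<open>w = u @ [n]\<close> by (auto simp: incr_subseqs_def sorted_wrt_append)
    ultimately show ?thesis by blast
  next
    case 3
    have "set v \<subseteq> set B" using 3(2) by (rule subseq_set_subset)
    moreover have "\<forall>a\<in>set u. \<forall>b\<in>set v. a < b" using w(3) uv(1) by (auto simp: sorted_wrt_append)
    ultimately have "u = []"
      using BA uA 3(1) by (cases u; cases v) force+
    then show ?thesis using w uv 3 by (auto simp: incr_subseqs_def)
  qed
next
  fix w assume "w \<in> ?R"
  then consider "w \<in> incr_subseqs (Suc i) A" | u where "w = u @ [n]" "u \<in> incr_subseqs i A"
    | "w \<in> incr_subseqs (Suc i) B" by blast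
  then show "w \<in> ?L"
  proof cases
    case 1
    then show ?thesis by (auto simp: incr_subseqs_def intro: subseq_rev_drop_many)
  next
    case (2 u)
    then have "subseq u A" by (simp add: incr_subseqs_def)
    moreover have "subseq [n] (n # B)" by simp
    ultimately have "subseq w (A @ n # B)" unfolding 2(1) by (rule list_emb_append_mono)
    moreover have "\<forall>a\<in>set u. a < n" using An subseq_set_subset[OF \<open>subseq u A\<close>] by auto
    ultimately show ?thesis using 2 by (auto simp: incr_subseqs_def sorted_wrt_append)
  next
    case 3
    then show ?thesis by (auto simp: incr_subseqs_def)
  qed
qed

text \<open>The three sets of the preceding decomposition are disjoint: containing \<open>n\<close>
  separates the first two, and the last entry separates both from the third. Appending
  \<open>n\<close> is injective, so the cardinalities add.\<close>

lemma occr_incr_append_max: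
  assumes BA: "\<And>a b. a \<in> set A \<Longrightarrow> b \<in> set B \<Longrightarrow> b < a"
    and An: "\<And>a. a \<in> set A \<Longrightarrow> a < n" and Bn: "\<And>b. b \<in> set B \<Longrightarrow> b < n"
    and d: "distinct A" "distinct B"
  shows "occr [1..<Suc (Suc i)] (A @ n # B) =
    occr [1..<Suc (Suc i)] A + occr [1..<Suc i] A + occr [1..<Suc (Suc i)] B"
proof -
  have dis: "distinct (A @ n # B)"
    using d BA An Bn by fastforce
  have sub: "set w \<subseteq> set C" if "w \<in> incr_subseqs j C" for w j C
    using that subseq_set_subset[of w C] by (auto simp: incr_subseqs_def)
  have ne: "w \<noteq> []" if "w \<in> incr_subseqs (Suc j) C" for w j C
    using that by (auto simp: incr_subseqs_def)
  have disj1: "incr_subseqs (Suc i) A \<inter> (\<lambda>w. w @ [n]) ` incr_subseqs i A = {}"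
    using sub An by fastforce
  have "w \<notin> incr_subseqs (Suc i) B"
    if w: "w \<in> incr_subseqs (Suc i) A \<union> (\<lambda>w. w @ [n]) ` incr_subseqs i A" for w
  proof
    assume wB: "w \<in> incr_subseqs (Suc i) B"
    \<comment> \<open>The length is \<open>Suc i\<close>, so \<open>w\<close> is nonempty and has a
      last entry to compare.\<close>
    have "last w \<in> set w" using ne[OF wB] by simp
    moreover have "last w \<in> set A \<or> last w = n"
      using w sub ne by (fastforce dest: last_in_set)
    ultimately show False using sub[OF wB] BA Bn by blast
  qed
  then have disj2: "(incr_subseqs (Suc i) A \<union> (\<lambda>w. w @ [n]) ` incr_subseqs i A)
      \<inter> incr_subseqs (Suc i) B = {}" by blast
  have "card ((\<lambda>w. w @ [n]) ` incr_subseqs i A) = card (incr_subseqs i A)"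
    by (rule card_image) (auto simp: inj_on_def)
  moreover have "incr_subseqs (Suc i) (A @ n # B) =
      incr_subseqs (Suc i) A \<union> (\<lambda>w. w @ [n]) ` incr_subseqs i A \<union> incr_subseqs (Suc i) B"
    using BA An Bn by (rule incr_subseqs_append_max)
  ultimately show ?thesis
    unfolding occr_incr[OF dis] occr_incr[OF d(1)] occr_incr[OF d(2)]
    by (simp add: card_Un_disjoint finite_incr_subseqs disj1 disj2)
qed

section \<open>Avoidance of 132 and the maximum\<close>

text \<open>Suppose \<open>a\<close>, \<open>b\<close>, \<open>c\<close> form a 132 pattern. If the
  cut before \<open>n\<close> separates \<open>a\<close> from \<open>c\<close>, then
  \<open>c\<close> is not \<open>n\<close> and lies in \<open>B\<close>, below \<open>a\<close>,
  contrary to \<open>a < c\<close>. Otherwise all three entries lie in \<open>A\<close> or all lie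
  in \<open>B\<close>, since \<open>n\<close> cannot play the smallest letter
  \<open>a\<close>.\<close>

lemma occr_132_append_max:
  assumes BA: "\<And>a b. a \<in> set A \<Longrightarrow> b \<in> set B \<Longrightarrow> b < a"
    and An: "\<And>a. a \<in> set A \<Longrightarrow> a < n" and Bn: "\<And>b. b \<in> set B \<Longrightarrow> b < n"
    and A: "occr [1, 3, 2] A = 0" and B: "occr [1, 3, 2] B = 0"
  shows "occr [1, 3, 2] (A @ n # B) = 0"
  unfolding occr_132_eq_0_iff
proof (clarify)
  fix a b c assume abc: "subseq [a, b, c] (A @ n # B)" "a < c" "c < b"
  then obtain u v where uv: "[a, b, c] = u @ v" "subseq u A" "subseq v (n # B)"
    by (auto elim: subseq_appendE)
  have uA: "set u \<subseteq> set A" using uv(2) by (rule subseq_set_subset)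
  have vB: "set v \<subseteq> set (n # B)" using uv(3) by (rule subseq_set_subset)
  \<comment> \<open>Only the first letter of \<open>v\<close> can be the displayed \<open>n\<close>;
    the remaining letters come from \<open>B\<close>.\<close>
  have tl: "subseq (tl v) B" using uv(3) by (cases v) (auto split: if_splits dest: subseq_Cons')
  have tlB: "set (tl v) \<subseteq> set B" using tl by (rule subseq_set_subset)
  have "u = [] \<and> v = [a, b, c] \<or> u = [a] \<and> v = [b, c] \<or> u = [a, b] \<and> v = [c]
      \<or> u = [a, b, c] \<and> v = []"
    using uv(1) by (cases u; cases "tl u"; cases "tl (tl u)") auto
  then consider "u = []" "v = [a, b, c]" | "u = [a]" "v = [b, c]" | "u = [a, b]" "v = [c]"
    | "u = [a, b, c]" "v = []" by blast
  then show False
  proof cases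
    case 1
    then have "a \<noteq> n" using tlB Bn abc by fastforce
    then have "subseq [a, b, c] B" using uv(3) 1 by simp
    then show False using B abc occr_132_eq_0_iff by blast
  next
    case 2
    then show False using tlB BA uA abc by fastforce
  next
    case 3
    then have "c \<noteq> n" using uA An abc by fastforce
    then show False using 3 vB BA uA abc by fastforce
  next
    case 4
    then show False using A uv(2) abc occr_132_eq_0_iff by blast
  qed
qed

lemma occr_132_subseq:
  assumes "occr [1, 3, 2] \<sigma> = 0" "subseq \<tau> \<sigma>"
  shows "occr [1, 3, 2] \<tau> = 0"
  using assms subseq_order.trans unfolding occr_132_eq_0_iff by blast

text \<open>If \<open>a < b\<close>, then \<open>a\<close>, \<open>n\<close>, \<open>b\<close> would
  be an occurrence of 132.\<close>

lemma occr_132_append_max_split: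
  assumes "occr [1, 3, 2] (A @ n # B) = 0" "distinct (A @ n # B)"
    and Bn: "\<And>b. b \<in> set B \<Longrightarrow> b < n"
    and a: "a \<in> set A" and b: "b \<in> set B"
  shows "b < a"
proof (rule ccontr)
  assume "\<not> b < a"
  moreover have "a \<noteq> b" using assms by auto
  ultimately have "a < b" by simp
  have "subseq ([a] @ [n, b]) (A @ n # B)"
    using a b by (intro list_emb_append_mono) (auto simp: subseq_singleton_left)
  then have "subseq [a, n, b] (A @ n # B)" by simp
  then show False using assms(1) \<open>a < b\<close> Bn[OF b] unfolding occr_132_eq_0_iff by blast
qed

text \<open>\<open>T\<close> is closed downwards in \<open>{1..N}\<close>, hence an initial segment
  whose endpoint is its cardinality. For the entries of the two blocks this means that the position
  of the maximum fixes both sets of values.\<close>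

lemma lower_set_eq_atLeastAtMost:
  fixes S T :: "nat set"
  assumes un: "S \<union> T = {1..N}" and lt: "\<And>a b. a \<in> S \<Longrightarrow> b \<in> T \<Longrightarrow> b < a"
  shows "T = {1..card T}" "S = {Suc (card T)..N}"
proof -
  have fin: "finite T" using un finite_Un[of S T] by simp
  have disj: "S \<inter> T = {}" using lt by blast
  have "T = {1..card T}"
  proof (cases "T = {}")
    case False
    have "T = {1..Max T}"
    proof (intro equalityI subsetI)
      fix j assume j: "j \<in> {1..Max T}"
      have M: "Max T \<in> T" using fin False by simp
      then have "Max T \<le> N" using un by (metis UnCI atLeastAtMost_iff)
      then have "j \<in> S \<union> T" using j un by auto
      then show "j \<in> T" using lt[of j "Max T"] M j by auto
    qed (use un fin in auto)
    then show ?thesis by (metis card_atLeastAtMost diff_Suc_1)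
  qed auto
  then show T: "T = {1..card T}" .
  have "S = {1..N} - T" using un disj by blast
  then show "S = {Suc (card T)..N}" by (subst (asm) T) auto
qed

section \<open>Bijection with pairs of shorter avoiders\<close>

lemma Av132_iff:
  "\<sigma> \<in> Av132 n \<longleftrightarrow> distinct \<sigma> \<and> set \<sigma> = {1..n} \<and> occr [1, 3, 2] \<sigma> = 0"
  by (auto simp: Av132_def permutations_of_set_def)

lemma finite_Av132: "finite (Av132 n)"
  by (simp add: Av132_def)

text \<open>\<open>k\<close> is the position of \<open>n\<close> counted from 1. \<open>A\<close> is
  kept as a permutation of \<open>{1..k - 1}\<close>, and the shift by \<open>n - k\<close>, the
  length of \<open>B\<close>, places it just above the values of \<open>B\<close>.\<close>

definition join132 :: "nat \<Rightarrow> nat \<times> nat list \<times> nat list \<Rightarrow> nat list" where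
  "join132 n = (\<lambda>(k, A, B). map (\<lambda>a. a + (n - k)) A @ n # B)"

lemma strict_mono_add_nat: "strict_mono (\<lambda>a::nat. a + d)"
  by (simp add: strict_mono_def)

lemma length_Av132: "\<sigma> \<in> Av132 n \<Longrightarrow> length \<sigma> = n"
  by (metis Av132_iff card_atLeastAtMost diff_Suc_1 distinct_card)

text \<open>The conclusions follow the order of the premises of \<open>occr_incr_append_max\<close>,
  the first three also being those of \<open>occr_132_append_max\<close>.\<close>

lemma join132_bounds:
  assumes "k \<in> {1..n}" "A \<in> Av132 (k - 1)" "B \<in> Av132 (n - k)"
  defines "A' \<equiv> map (\<lambda>a. a + (n - k)) A"
  shows "a \<in> set A' \<Longrightarrow> b \<in> set B \<Longrightarrow> b < a" "a \<in> set A' \<Longrightarrow> a < n"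
    "b \<in> set B \<Longrightarrow> b < n" "distinct A'" "distinct B"
  using assms by (auto simp: Av132_iff distinct_map inj_on_def)

lemma set_shift_Av132:
  assumes "k \<in> {1..n}" "A \<in> Av132 (k - 1)"
  shows "set (map (\<lambda>a. a + (n - k)) A) = {Suc (n - k)..n - 1}"
proof -
  have "set (map (\<lambda>a. a + (n - k)) A) = (\<lambda>a. a + (n - k)) ` {1..k - 1}"
    using assms by (simp add: Av132_iff)
  also have "\<dots> = {1 + (n - k)..k - 1 + (n - k)}" by (rule image_add_atLeastAtMost')
  finally show ?thesis using assms by simp
qed

text \<open>Injectivity: the unique \<open>n\<close> marks the cut, the length of \<open>B\<close>
  gives \<open>k\<close>, and the shift can be undone. Surjectivity: cut at \<open>n\<close>; the
  values of both blocks are forced to be intervals, and shifting the left one down gives a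
  preimage.\<close>

lemma bij_betw_join132:
  assumes "n \<ge> 1"
  shows "bij_betw (join132 n) (SIGMA k:{1..n}. Av132 (k - 1) \<times> Av132 (n - k)) (Av132 n)"
  unfolding bij_betw_def
proof (intro conjI inj_onI equalityI subsetI)
  fix p q
  assume p: "p \<in> (SIGMA k:{1..n}. Av132 (k - 1) \<times> Av132 (n - k))"
    and q: "q \<in> (SIGMA k:{1..n}. Av132 (k - 1) \<times> Av132 (n - k))"
    and eq: "join132 n p = join132 n q"
  obtain k A B where p': "p = (k, A, B)" by (cases p)
  obtain l C D where q': "q = (l, C, D)" by (cases q)
  have k: "k \<in> {1..n}" "A \<in> Av132 (k - 1)" "B \<in> Av132 (n - k)" using p p' by auto
  have l: "l \<in> {1..n}" "C \<in> Av132 (l - 1)" "D \<in> Av132 (n - l)" using q q' by auto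
  \<comment> \<open>With \<open>n\<close> absent from both blocks of the first word, equality of the
    words forces the cuts to coincide.\<close>
  have "n \<notin> set (map (\<lambda>a. a + (n - k)) A)" "n \<notin> set B"
    using join132_bounds(2,3)[OF k] by blast+
  moreover have "map (\<lambda>a. a + (n - k)) A @ n # B = map (\<lambda>a. a + (n - l)) C @ n # D"
    using eq by (simp add: join132_def p' q')
  ultimately have e: "map (\<lambda>a. a + (n - k)) A = map (\<lambda>a. a + (n - l)) C" "B = D"
    using append_Cons_eq_iff[of n "map (\<lambda>a. a + (n - k)) A" B "map (\<lambda>a. a + (n - l)) C" D]
    by blast+
  have "n - k = n - l" using length_Av132[OF k(3)] length_Av132[OF l(3)] e(2) by simp
  then have "k = l" using k(1) l(1) by auto
  moreover have "A = C"
    using e(1) strict_mono_imp_inj_on[OF strict_mono_add_nat, of _ UNIV] inj_map_eq_map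
    unfolding \<open>k = l\<close> by blast
  ultimately show "p = q" using e(2) p' q' by simp
next
  fix \<sigma> assume "\<sigma> \<in> join132 n ` (SIGMA k:{1..n}. Av132 (k - 1) \<times> Av132 (n - k))"
  then obtain k A B where k: "k \<in> {1..n}" "A \<in> Av132 (k - 1)" "B \<in> Av132 (n - k)"
    and \<sigma>: "\<sigma> = map (\<lambda>a. a + (n - k)) A @ n # B" by (auto simp: join132_def)
  note b = join132_bounds[OF k]
  have "occr [1, 3, 2] \<sigma> = 0"
    unfolding \<sigma>
  proof (rule occr_132_append_max[OF b(1-3)])
    show "occr [1, 3, 2] (map (\<lambda>a. a + (n - k)) A) = 0"
      using k by (simp only: Av132_iff occr_map_strict_mono[OF strict_mono_add_nat])
    show "occr [1, 3, 2] B = 0" using k by (simp only: Av132_iff)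
  qed
  moreover have "distinct \<sigma>" unfolding \<sigma> using b by fastforce
  moreover have "set \<sigma> = {Suc (n - k)..n - 1} \<union> {n} \<union> {1..n - k}"
    using set_shift_Av132[OF k(1,2)] k(3) by (simp add: \<sigma> Av132_iff)
  moreover have "{Suc (n - k)..n - 1} \<union> {n} \<union> {1..n - k} = {1..n}" using k(1) by auto
  ultimately show "\<sigma> \<in> Av132 n" by (simp add: Av132_iff)
next
  fix \<sigma> assume "\<sigma> \<in> Av132 n"
  then have \<sigma>: "distinct \<sigma>" "set \<sigma> = {1..n}" "occr [1, 3, 2] \<sigma> = 0" by (simp_all add: Av132_iff)
  then have "n \<in> set \<sigma>" using assms by simp
  then obtain A B where AB: "\<sigma> = A @ n # B" by (meson split_list)
  have "set A \<union> set B = set \<sigma> - {n}" using \<sigma>(1) AB by auto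
  also have "\<dots> = {1..n - 1}" unfolding \<sigma>(2) by auto
  finally have un: "set A \<union> set B = {1..n - 1}" .
  have Bn: "b < n" if "b \<in> set B" for b
  proof -
    have "b \<in> {1..n - 1}" using that un by blast
    then show ?thesis by auto
  qed
  have BA: "b < a" if "a \<in> set A" "b \<in> set B" for a b
    using occr_132_append_max_split[of A n B] \<sigma> AB Bn that by blast
  have dB: "distinct A" "distinct B" using \<sigma>(1) AB by auto
  have lB: "card (set B) = length B" using dB distinct_card by blast
  note S = lower_set_eq_atLeastAtMost[OF un BA, simplified lB]
  have "length \<sigma> = n" using \<sigma> distinct_card[of \<sigma>] by simp
  define k where "k = Suc (length A)"
  have k: "k \<in> {1..n}" "length B = n - k"
    using \<open>length \<sigma> = n\<close> AB by (auto simp: k_def)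
  \<comment> \<open>Subtraction on \<open>nat\<close> truncates, but by \<open>S(2)\<close> every
    entry of \<open>A\<close> exceeds \<open>n - k\<close>, so adding \<open>n - k\<close> back
    restores \<open>A\<close>.\<close>
  define A0 where "A0 = map (\<lambda>a. a - (n - k)) A"
  have A: "A = map (\<lambda>a. a + (n - k)) A0"
    unfolding A0_def map_map using S(2) k by (intro map_idI[symmetric]) auto
  have "subseq A \<sigma>" "subseq B \<sigma>"
    using AB by (auto intro: subseq_rev_drop_many)
  then have o: "occr [1, 3, 2] A = 0" "occr [1, 3, 2] B = 0" using occr_132_subseq \<sigma>(3) by blast+
  have "occr [1, 3, 2] A0 = 0"
    using o(1) unfolding A occr_map_strict_mono[OF strict_mono_add_nat] .
  moreover have "distinct A0" using dB(1) unfolding A by (simp add: distinct_map)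
  moreover have "set A0 = {1..k - 1}"
  proof -
    have "(\<lambda>a. a + (n - k)) ` set A0 = {1 + (n - k)..k - 1 + (n - k)}"
      using S(2) k unfolding A by simp
    also have "\<dots> = (\<lambda>a. a + (n - k)) ` {1..k - 1}" by simp
    finally show ?thesis by (simp only: inj_image_eq_iff[OF inj_on_add'])
  qed
  ultimately have "A0 \<in> Av132 (k - 1)" by (simp add: Av132_iff)
  moreover have "B \<in> Av132 (n - k)" using dB S(1) o(2) k(2) by (simp add: Av132_iff)
  moreover have "\<sigma> = join132 n (k, A0, B)" using AB A by (simp add: join132_def)
  ultimately show "\<sigma> \<in> join132 n ` (SIGMA k:{1..n}. Av132 (k - 1) \<times> Av132 (n - k))"
    using k(1) by (intro image_eqI[of _ _ "(k, A0, B)"]) auto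
qed

section \<open>Weights under the decomposition\<close>

text \<open>After substitution \<open>x i\<close> collects \<open>e i\<close> from its own factor
  and \<open>e (i - 1)\<close> from the preceding one. For \<open>i = 2\<close> there is no
  preceding factor; the extra \<open>x 2 ^ e 1\<close> supplies it.\<close>

lemma prod_subst_args:
  fixes x :: "nat \<Rightarrow> 'a::comm_ring_1"
  assumes "m \<ge> 2"
  shows "x 2 ^ e 1 * (\<Prod>i=2..m. subst_args m x i ^ e i) =
    (\<Prod>i=2..m. x i ^ e i) * (\<Prod>i=2..m. x i ^ e (i - 1))"
proof -
  obtain l where m: "m = Suc l" and l: "l \<ge> 1" using assms by (cases m) auto
  have "(\<Prod>i=2..m. subst_args m x i ^ e i) =
      (\<Prod>i=2..l. x i ^ e i * x (Suc i) ^ e i) * x m ^ e m"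
    using l by (simp add: m subst_args_def power_mult_distrib)
  also have "\<dots> = (\<Prod>i=2..m. x i ^ e i) * (\<Prod>i=2..l. x (Suc i) ^ e i)"
    using l by (simp add: m prod.distrib algebra_simps)
  finally have 1: "(\<Prod>i=2..m. subst_args m x i ^ e i) = \<dots>" .
  have "(\<Prod>i=2..m. x i ^ e (i - 1)) = x 2 ^ e 1 * (\<Prod>i=Suc 2..Suc l. x i ^ e (i - 1))"
    using assms by (simp add: m prod.atLeast_Suc_atMost del: prod.cl_ivl_Suc)
  also have "\<dots> = x 2 ^ e 1 * (\<Prod>i=2..l. x (Suc i) ^ e i)"
    by (simp only: prod.shift_bounds_cl_Suc_ivl diff_Suc_1)
  finally show ?thesis by (simp add: 1 mult_ac)
qed

lemma weight_join132:
  fixes x :: "nat \<Rightarrow> 'a::comm_ring_1"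
  assumes "m \<ge> 2" and k: "k \<in> {1..n}" "A \<in> Av132 (k - 1)" "B \<in> Av132 (n - k)"
  shows "(\<Prod>i=2..m. x i ^ occr [1..<Suc i] (join132 n (k, A, B))) =
    x 2 ^ (k - 1) * (\<Prod>i=2..m. subst_args m x i ^ occr [1..<Suc i] A)
      * (\<Prod>i=2..m. x i ^ occr [1..<Suc i] B)"
proof -
  note b = join132_bounds[OF k]
  define e where "e i = occr [1..<Suc i] A" for i
  have dA: "distinct A" using k(2) by (simp add: Av132_iff)
  \<comment> \<open>Every single letter is increasing, so \<open>e 1\<close> is the length of
    \<open>A\<close>. This is the source of the power of \<open>x 2\<close> in the
    recurrence.\<close>
  have e1: "e 1 = k - 1"
    using length_Av132[OF k(2)] distinct_card[OF dA]
    unfolding e_def occr_incr[OF dA] incr_subseqs_one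
    by (simp add: card_image inj_on_def)
  have occ: "occr [1..<Suc i] (join132 n (k, A, B)) = e i + e (i - 1) + occr [1..<Suc i] B"
    if i2: "i \<in> {2..m}" for i
  proof -
    obtain j where i: "i = Suc j" using i2 by (cases i) auto
    show ?thesis
      unfolding join132_def prod.case i e_def diff_Suc_1
      by (subst occr_incr_append_max[OF b])
        (simp_all only: occr_map_strict_mono[OF strict_mono_add_nat])
  qed
  have "(\<Prod>i=2..m. x i ^ occr [1..<Suc i] (join132 n (k, A, B))) =
      (\<Prod>i=2..m. x i ^ e i * x i ^ e (i - 1) * x i ^ occr [1..<Suc i] B)"
    by (intro prod.cong refl) (simp only: occ power_add)
  also have "\<dots> = x 2 ^ e 1 * (\<Prod>i=2..m. subst_args m x i ^ e i)
      * (\<Prod>i=2..m. x i ^ occr [1..<Suc i] B)"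
    by (simp only: prod.distrib prod_subst_args[OF assms(1)])
  finally show ?thesis unfolding e1 unfolding e_def .
qed

section \<open>Recurrence and generating function\<close>

lemma Qpoly_rec:
  fixes x :: "nat \<Rightarrow> 'a::comm_ring_1"
  assumes "m \<ge> 2" "n \<ge> 1"
  shows "Qpoly m n x =
    (\<Sum>k=1..n. x 2 ^ (k - 1) * Qpoly m (k - 1) (subst_args m x) * Qpoly m (n - k) x)"
proof -
  let ?w = "\<lambda>y::nat \<Rightarrow> 'a. \<lambda>\<sigma>. \<Prod>i=2..m. y i ^ occr [1..<Suc i] \<sigma>"
  \<comment> \<open>Reindexing along the bijection turns the sum into one over triples, where the
    weight factors into a part from \<open>A\<close> and a part from \<open>B\<close>.\<close>
  have "Qpoly m n x =
      (\<Sum>p\<in>(SIGMA k:{1..n}. Av132 (k - 1) \<times> Av132 (n - k)). ?w x (join132 n p))"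
    unfolding Qpoly_def by (rule sum.reindex_bij_betw[OF bij_betw_join132[OF assms(2)], symmetric])
  also have "\<dots> = (\<Sum>k=1..n. \<Sum>q\<in>Av132 (k - 1) \<times> Av132 (n - k). ?w x (join132 n (k, q)))"
    by (subst sum.Sigma) (auto simp: finite_Av132 simp del: upt_Suc)
  also have "\<dots> = (\<Sum>k=1..n. \<Sum>(A, B)\<in>Av132 (k - 1) \<times> Av132 (n - k).
      x 2 ^ (k - 1) * ?w (subst_args m x) A * ?w x B)"
    by (intro sum.cong refl) (clarify, rule weight_join132[OF assms(1)], auto)
  also have "\<dots> = (\<Sum>k=1..n. x 2 ^ (k - 1) * Qpoly m (k - 1) (subst_args m x) * Qpoly m (n - k) x)"
    unfolding Qpoly_def sum.cartesian_product[symmetric]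
    by (simp only: sum_distrib_left sum_distrib_right mult.assoc)
      (intro sum.cong refl sum.swap)
  finally show ?thesis .
qed

lemma Qpoly_0: "Qpoly m 0 x = (1::'a::comm_ring_1)"
proof -
  have "occr [1, 3, 2] [] = 0" unfolding occr_132_eq_0_iff by simp
  then have "Av132 0 = {[]}" by (auto simp: Av132_iff)
  moreover have "occr [1..<Suc i] [] = 0" if "i \<in> {2..m}" for i
  proof -
    \<comment> \<open>Since \<open>i\<close> is at least 2, the empty word has no subsequence of
      length \<open>i\<close>; all exponents vanish and the weight is 1.\<close>
    have "incr_subseqs i [] = {}"
      using that by (auto simp: incr_subseqs_def dest: list_emb_Nil2)
    then show ?thesis using occr_incr[of "[]" i] by (simp del: upt_Suc)
  qed
  ultimately show ?thesis by (simp add: Qpoly_def del: upt_Suc)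
qed

theorem theorem4:
  fixes m :: nat and x :: "nat \<Rightarrow> 'a::comm_ring_1"
  assumes "m \<ge> 2"
  shows "(\<forall>n\<ge>1. Qpoly m n x =
            (\<Sum>k=1..n. x 2 ^ (k - 1) * Qpoly m (k - 1) (subst_args m x) * Qpoly m (n - k) x))
       \<and> Qgf m x =
            1 + fps_X * fps_compose (Qgf m (subst_args m x)) (fps_X * fps_const (x 2)) * Qgf m x"
proof
  show "\<forall>n\<ge>1. Qpoly m n x =
      (\<Sum>k=1..n. x 2 ^ (k - 1) * Qpoly m (k - 1) (subst_args m x) * Qpoly m (n - k) x)"
    using Qpoly_rec[OF assms] by blast
  let ?F = "fps_compose (Qgf m (subst_args m x)) (fps_X * fps_const (x 2))"
  \<comment> \<open>Replacing \<open>t\<close> by \<open>t\<close> times \<open>x 2\<close> scales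
    the coefficient of index \<open>n\<close> by \<open>x 2 ^ n\<close>. The factors are commuted to
    match \<open>fps_compose_linear\<close>.\<close>
  have F: "?F = Abs_fps (\<lambda>n. x 2 ^ n * Qpoly m n (subst_args m x))"
    by (subst mult.commute) (simp add: fps_compose_linear Qgf_def)
  show "Qgf m x = 1 + fps_X * ?F * Qgf m x"
  proof (rule fps_ext)
    fix n
    show "fps_nth (Qgf m x) n = fps_nth (1 + fps_X * ?F * Qgf m x) n"
    proof (cases n)
      case 0
      then show ?thesis by (simp add: Qgf_def Qpoly_0 mult.assoc)
    next
      case (Suc j)
      \<comment> \<open>The factor \<open>fps_X\<close> lowers the coefficient index by one, so the
        sum over \<open>k\<close> from 1 is shifted to start at 0, where it is the Cauchy product at
        \<open>j\<close>.\<close>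
      have "Qpoly m (Suc j) x = (\<Sum>k=Suc 0..Suc j.
          x 2 ^ (k - 1) * Qpoly m (k - 1) (subst_args m x) * Qpoly m (Suc j - k) x)"
        by (subst Qpoly_rec[OF assms]) (simp_all del: sum.cl_ivl_Suc)
      also have "\<dots> = (\<Sum>k=0..j. x 2 ^ k * Qpoly m k (subst_args m x) * Qpoly m (j - k) x)"
        by (simp only: sum.shift_bounds_cl_Suc_ivl diff_Suc_1 diff_Suc_Suc)
      also have "\<dots> = fps_nth (?F * Qgf m x) j"
        unfolding F fps_mult_nth by (simp add: Qgf_def)
      finally show ?thesis
        unfolding Suc by (simp add: Qgf_def mult.assoc)
    qed
  qed
qed

end
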